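(* For every integer $n\ge 4$, $$p(n)=\binom{n-1}{\lfloor n/2\rfloor-1}.$$
   Context: For a vector $\mathbf{v}\in\{0,1\}^n$ and $r\in[n]=\{1,\ldots,n\}$, $\mathbf{v}[r]$ denotes its $r$-th coordinate. A set of binary vectors $\mathcal{V}=\{\mathbf{v}_1,\ldots,\mathbf{v}_k\}\subseteq\{0,1\}^n$ is called perfect if (i) $|\mathcal{V}|\ge 2$, and (ii) for every pair $(\mathbf{v}_i,\mathbf{v}_j)$ with $1\le i<j\le k$ and every $\alpha\in\{0,1\}^2$, there is some $r\in[n]$ with $\mathbf{v}_i[r]\,\mathbf{v}_j[r]=\alpha$. For $n\ge 4$ (for which perfect sets exist), $p(n)$ denotes the maximum size of a perfect set of vectors of length $n$. *)

theory Defs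
  imports Complex_Main
begin

(* A vector in {0,1}^n is a bool list of length n, with False for 0 and True for 1.
   The r-th coordinate, r in {1,...,n}, is the list entry at position r - 1. *)
definition bit_vectors :: "nat \<Rightarrow> bool list set" where
  "bit_vectors n = {v. length v = n}"

(* Quantifying over all ordered pairs of distinct vectors agrees with quantifying over
   pairs i < j in an enumeration of V, because all (a, b) in {0,1}^2 are required. *)
definition perfect :: "nat \<Rightarrow> bool list set \<Rightarrow> bool" where
  "perfect n V \<longleftrightarrow> V \<subseteq> bit_vectors n \<and> card V \<ge> 2 \<and>
     (\<forall>u\<in>V. \<forall>v\<in>V. u \<noteq> v \<longrightarrow> (\<forall>a b. \<exists>r<n. u ! r = a \<and> v ! r = b))"

(* The set of sizes is always finite; it is nonempty, so that Max is meaningful,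
   exactly when perfect sets of length n exist, that is for n >= 4. *)
definition p :: "nat \<Rightarrow> nat" where
  "p n = Max {card V | V. perfect n V}"

end

theory Submission
  imports Defs "HOL-Combinatorics.Multiset_Permutations"
begin

text \<open>
  Replacing a vector by its complement preserves perfection, so every vector may be taken to have
  support of size at most n/2. The supports then form an intersecting antichain F, and Katona's cycle
  method gives Bollobas's inequality: the sum of 1 / C(n-1, |A|-1) over F is at most 1. Each summand
  is at least 1 / C(n-1, m-1) with m = n div 2. Equality is attained by all vectors of
  weight m with first coordinate 1.
\<close>

section \<open>Arcs of a cyclic arrangement and Katona's local bound\<close>

text \<open>The second disjunct is the part of the arc that wraps past position
  \<open>n - 1\<close>. Avoiding \<open>mod\<close> lets inclusion and disjointness of arcs be
  settled by linear arithmetic.\<close>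

definition arc :: "nat \<Rightarrow> nat \<Rightarrow> nat \<Rightarrow> nat set" where
  "arc n i k = {r. r < n \<and> (i \<le> r \<and> r < i + k \<or> r + n < i + k)}"

lemma arc_eq_image:
  assumes "i < n" "k \<le> n"
  shows "arc n i k = (\<lambda>j. (i + j) mod n) ` {..<k}"
proof (intro set_eqI iffI)
  fix r assume r: "r \<in> arc n i k"
  show "r \<in> (\<lambda>j. (i + j) mod n) ` {..<k}"
  proof (cases "i \<le> r \<and> r < i + k")
    case True
    then show ?thesis using r by (intro image_eqI[of _ _ "r - i"]) (auto simp: arc_def)
  next
    case False
    then show ?thesis using r assms
      by (intro image_eqI[of _ _ "r + n - i"]) (auto simp: arc_def)
  qed
next
  fix r assume "r \<in> (\<lambda>j. (i + j) mod n) ` {..<k}"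
  then obtain j where j: "j < k" "r = (i + j) mod n" by auto
  show "r \<in> arc n i k"
  proof (cases "i + j < n")
    case True
    then show ?thesis using j by (auto simp: arc_def)
  next
    case False
    then have "r = i + j - n" using j assms by (simp add: mod_if)
    then show ?thesis using j assms False by (auto simp: arc_def)
  qed
qed

text \<open>Translates blocks of consecutive entries of a cyclic arrangement into arcs of positions.
  When \<open>xs\<close> is distinct, \<open>(!) xs\<close> is injective on positions, so blocks
  intersect or contain one another exactly as their arcs do.\<close>

lemma set_take_rotate:
  assumes "i < length xs" "k \<le> length xs"
  shows "set (take k (rotate i xs)) = (!) xs ` arc (length xs) i k"
proof -
  have "set (take k (rotate i xs)) = (!) (rotate i xs) ` {..<k}"
    using assms nth_image[of k "rotate i xs"] by (simp add: lessThan_atLeast0)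
  also have "\<dots> = (\<lambda>j. xs ! ((i + j) mod length xs)) ` {..<k}"
    using assms by (intro image_cong) (auto simp: nth_rotate)
  finally show ?thesis
    by (simp add: arc_eq_image[OF assms] image_image)
qed

lemma card_initial_arcs_le:
  assumes xs: "distinct xs" "length xs = n"
    and small: "\<And>A. A \<in> F \<Longrightarrow> 2 * card A \<le> n"
    and meet: "\<And>A B. A \<in> F \<Longrightarrow> B \<in> F \<Longrightarrow> A \<inter> B \<noteq> {}"
    and anti: "\<And>A B. A \<in> F \<Longrightarrow> B \<in> F \<Longrightarrow> A \<subseteq> B \<Longrightarrow> A = B"
    and C: "C \<in> F" "set (take (card C) xs) = C"
  shows "card {(i, A). i < n \<and> A \<in> F \<and> set (take (card A) (rotate i xs)) = A} \<le> card C"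
    (is "card ?T \<le> _")
proof -
  \<comment> \<open>An arc meeting C without containing it starts or ends inside C. An arc ending just before
    position r is disjoint from one starting at r, so every r accounts for only one arc.\<close>
  define g :: "nat \<times> 'a set \<Rightarrow> nat" where
    "g = (\<lambda>(i, A). if i < card C then i else i + card A - n)"
  have "C \<noteq> {}" using meet[OF C(1) C(1)] by auto
  then have npos: "0 < n" using C xs by auto
  have C_arc: "C = (!) xs ` arc n 0 (card C)"
    using set_take_rotate[of 0 xs "card C"] C small[OF C(1)] xs npos by simp
  have eq: "A = (!) xs ` arc n i (card A)" if "(i, A) \<in> ?T" for i A
    using that set_take_rotate[of i xs "card A"] xs small[of A] by auto
  have inj: "inj_on ((!) xs) {..<n}"
    using xs by (simp add: inj_on_nth)
  have arc_sub: "arc n i k \<subseteq> {..<n}" for i k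
    by (auto simp: arc_def)
  have meet_arc: "arc n i (card A) \<inter> arc n j (card B) \<noteq> {}"
    if "A \<in> F" "B \<in> F" "A = (!) xs ` arc n i (card A)" "B = (!) xs ` arc n j (card B)" for i j A B
  proof -
    have "A \<inter> B = (!) xs ` (arc n i (card A) \<inter> arc n j (card B))"
      using that(3,4) inj_on_image_Int[OF inj arc_sub arc_sub] by metis
    then show ?thesis using meet[OF that(1,2)] by auto
  qed
  have anti_arc: "A = B"
    if "A \<in> F" "B \<in> F" "A = (!) xs ` arc n i (card A)" "B = (!) xs ` arc n j (card B)"
      "arc n i (card A) \<subseteq> arc n j (card B)" for i j A B
    by (metis anti image_mono that)
  \<comment> \<open>An arc starting outside \<open>C\<close> can meet \<open>C\<close> only by
    wrapping around. If it reached the end of the arc of \<open>C\<close>, it would contain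
    \<open>C\<close>, hence equal it by the antichain property, which forces \<open>i >= n\<close>.
    Consequently the subtraction of \<open>n\<close> in \<open>g\<close> is never truncated.\<close>
  have end_in: "n < i + card A \<and> i + card A < n + card C"
    if T: "(i, A) \<in> ?T" and "\<not> i < card C" for i A
  proof -
    have AF: "A \<in> F" and "i < n" using T by auto
    have "n < i + card A"
      using meet_arc[OF AF C(1) eq[OF T] C_arc] that(2) by (auto simp: arc_def)
    moreover have "i + card A < n + card C"
    proof (rule ccontr)
      assume "\<not> i + card A < n + card C"
      then have "C = A"
        by (intro anti_arc[OF C(1) AF C_arc eq[OF T]]) (auto simp: arc_def)
      with \<open>\<not> i + card A < n + card C\<close> \<open>i < n\<close> show False by auto
    qed
    ultimately show ?thesis by blast
  qed
  \<comment> \<open>Arcs with a common start are nested, and so are arcs with a common end; the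
    antichain property then identifies the two sets.\<close>
  have same_start: "A = B" if "(i, A) \<in> ?T" "(i, B) \<in> ?T" for i A B
  proof (cases "card A \<le> card B")
    case True
    then show ?thesis using that
      by (intro anti_arc[OF _ _ eq[OF that(1)] eq[OF that(2)]]) (auto simp: arc_def)
  next
    case False
    then have "B = A" using that
      by (intro anti_arc[OF _ _ eq[OF that(2)] eq[OF that(1)]]) (auto simp: arc_def)
    then show ?thesis ..
  qed
  have same_end: "A = B" if "(i, A) \<in> ?T" "(j, B) \<in> ?T" "i + card A = j + card B" for i j A B
  proof (cases "j \<le> i")
    case True
    then show ?thesis using that
      by (intro anti_arc[OF _ _ eq[OF that(1)] eq[OF that(2)]]) (auto simp: arc_def)
  next
    case False
    then have "B = A" using that
      by (intro anti_arc[OF _ _ eq[OF that(2)] eq[OF that(1)]]) (auto simp: arc_def)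
    then show ?thesis ..
  qed
  \<comment> \<open>The half-size bound is decisive here: the arc ending at \<open>i - 1\<close> and
    the arc starting at \<open>i\<close> have total length at most \<open>n\<close>, so they do not
    overlap on the far side of the cycle and are disjoint.\<close>
  have start_end: False
    if T: "(i, A) \<in> ?T" "(j, B) \<in> ?T" and ij: "i < card C" "\<not> j < card C" "i = j + card B - n"
    for i j A B
  proof -
    have F: "A \<in> F" "B \<in> F" "i < n" "j < n" using T by auto
    have "n < j + card B" using end_in T(2) ij(2) by blast
    moreover have "2 * card A \<le> n" "2 * card B \<le> n" using small F by auto
    ultimately show False
      using meet_arc[OF F(1,2) eq[OF T(1)] eq[OF T(2)]] ij F by (auto simp: arc_def)
  qed
  have "inj_on g ?T"
  proof (rule inj_onI)
    fix x y assume xy: "x \<in> ?T" "y \<in> ?T" "g x = g y"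
    obtain i A j B where x: "x = (i, A)" and y: "y = (j, B)" by fastforce
    have T: "(i, A) \<in> ?T" "(j, B) \<in> ?T" using xy(1,2) by (simp_all only: x y)
    have g_eq: "(if i < card C then i else i + card A - n) = (if j < card C then j else j + card B - n)"
      using xy(3) by (simp add: g_def x y)
    consider "i < card C" "j < card C" | "i < card C" "\<not> j < card C"
      | "\<not> i < card C" "j < card C" | "\<not> i < card C" "\<not> j < card C" by blast
    then show "x = y"
    proof cases
      case 1
      then have "i = j" using g_eq by simp
      then show ?thesis using same_start T x y by blast
    next
      case 2
      then have "i = j + card B - n" using g_eq by simp
      then show ?thesis using start_end[OF T] 2 by blast
    next
      case 3
      then have "j = i + card A - n" using g_eq by simp
      then show ?thesis using start_end[OF T(2,1)] 3 by blast
    next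
      case 4
      then have ends: "i + card A = j + card B"
        using g_eq end_in[OF T(1)] end_in[OF T(2)] by (simp; linarith)
      then have "A = B" by (rule same_end[OF T])
      then show ?thesis using ends x y by simp
    qed
  qed
  moreover have "g ` ?T \<subseteq> {..<card C}"
  proof
    fix r assume "r \<in> g ` ?T"
    then obtain i A where "(i, A) \<in> ?T" "r = g (i, A)" by auto
    then show "r \<in> {..<card C}"
      using end_in[of i A] by (cases "i < card C") (auto simp: g_def)
  qed
  ultimately show ?thesis
    using card_inj_on_le[of g ?T "{..<card C}"] by simp
qed

text \<open>Rotational symmetry: reading the cycle from position \<open>i\<close> moves the arc of
  \<open>C\<close> to position 0, where \<open>card_initial_arcs_le\<close> applies.\<close>

lemma card_arcs_le:
  assumes xs: "distinct xs" "length xs = n"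
    and fin: "finite F"
    and small: "\<And>A. A \<in> F \<Longrightarrow> 2 * card A \<le> n"
    and meet: "\<And>A B. A \<in> F \<Longrightarrow> B \<in> F \<Longrightarrow> A \<inter> B \<noteq> {}"
    and anti: "\<And>A B. A \<in> F \<Longrightarrow> B \<in> F \<Longrightarrow> A \<subseteq> B \<Longrightarrow> A = B"
    and C: "C \<in> F" "i < n" "set (take (card C) (rotate i xs)) = C"
  shows "card {(i, A). i < n \<and> A \<in> F \<and> set (take (card A) (rotate i xs)) = A} \<le> card C"
    (is "card (?T xs) \<le> _")
proof -
  \<comment> \<open>The new starting position is \<open>j - i\<close> modulo \<open>n\<close>;
    writing it as \<open>j + (n - i)\<close> avoids truncated subtraction.\<close>
  let ?h = "\<lambda>(j, A :: 'a set). ((j + (n - i)) mod n, A)"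
  have "inj_on ?h (?T xs)"
  proof (rule inj_onI)
    fix x y assume xy: "x \<in> ?T xs" "y \<in> ?T xs" "?h x = ?h y"
    obtain j A k B where [simp]: "x = (j, A)" "y = (k, B)" by fastforce
    have "(j + (n - i)) mod n = (k + (n - i)) mod n" using xy(3) by simp
    then have "(j + (n - i) + i) mod n = (k + (n - i) + i) mod n" by (metis mod_add_left_eq)
    then have "j mod n = k mod n" using C(2) by simp
    then show "x = y" using xy by simp
  qed
  moreover have "?h ` ?T xs \<subseteq> ?T (rotate i xs)"
  proof
    fix y assume "y \<in> ?h ` ?T xs"
    then obtain j A where j: "(j, A) \<in> ?T xs" "y = ((j + (n - i)) mod n, A)" by auto
    have "rotate ((j + (n - i)) mod n) (rotate i xs) = rotate (j + (n - i)) (rotate i xs)"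
      using xs by (metis length_rotate rotate_conv_mod)
    also have "\<dots> = rotate (j + n) xs"
      using C(2) by (simp add: rotate_rotate)
    also have "\<dots> = rotate j xs"
      using xs by (metis mod_add_self2 rotate_conv_mod)
    finally show "y \<in> ?T (rotate i xs)" using j C(2) by auto
  qed
  moreover have "finite (?T (rotate i xs))"
    by (rule finite_subset[of _ "{..<n} \<times> F"]) (use fin in auto)
  ultimately have "card (?T xs) \<le> card (?T (rotate i xs))"
    by (intro card_inj_on_le[of ?h])
  also have "\<dots> \<le> card C"
    using card_initial_arcs_le[of "rotate i xs" n F C] xs small meet anti C by simp
  finally show ?thesis .
qed

section \<open>Counting orderings\<close>

text \<open>Cutting such an ordering after \<open>card A\<close> entries leaves an ordering of
  \<open>A\<close> and one of \<open>S - A\<close>. The cut position is fixed, so concatenation is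
  injective and the count is a product.\<close>

lemma card_permutations_with_prefix_set:
  assumes "finite S" "A \<subseteq> S"
  shows "card {xs \<in> permutations_of_set S. set (take (card A) xs) = A}
    = fact (card A) * fact (card S - card A)"
proof -
  let ?L = "permutations_of_set A \<times> permutations_of_set (S - A)"
  have finA: "finite A" using assms finite_subset by blast
  have "{xs \<in> permutations_of_set S. set (take (card A) xs) = A} = (\<lambda>(ys, zs). ys @ zs) ` ?L"
    (is "?M = _")
  proof (intro set_eqI iffI)
    fix xs assume xs: "xs \<in> ?M"
    let ?ys = "take (card A) xs" and ?zs = "drop (card A) xs"
    have d: "distinct xs" "set xs = S" "set ?ys = A"
      using xs by (auto simp: permutations_of_set_def)
    have split: "xs = ?ys @ ?zs" by simp
    have "set ?ys \<union> set ?zs = S" using d(2) by (metis append_take_drop_id set_append)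
    moreover have "set ?ys \<inter> set ?zs = {}"
      using d(1) by (simp add: set_take_disj_set_drop_if_distinct)
    ultimately have "set ?zs = S - A" using d(3) by blast
    then have "(?ys, ?zs) \<in> ?L" using d by (auto simp: permutations_of_set_def)
    then show "xs \<in> (\<lambda>(ys, zs). ys @ zs) ` ?L" using split by (metis case_prod_conv image_eqI)
  next
    fix xs assume "xs \<in> (\<lambda>(ys, zs). ys @ zs) ` ?L"
    then obtain ys zs where "xs = ys @ zs" "distinct ys" "set ys = A" "distinct zs" "set zs = S - A"
      by (auto simp: permutations_of_set_def)
    then show "xs \<in> ?M"
      using assms distinct_card[of ys] by (auto simp: permutations_of_set_def)
  qed
  moreover have "inj_on (\<lambda>(ys, zs). ys @ zs) ?L"
  proof -
    have "length ys = card A" if "ys \<in> permutations_of_set A" for ys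
      using that distinct_card[of ys] by (simp add: permutations_of_set_def)
    then show ?thesis by (auto simp: inj_on_def)
  qed
  ultimately have "card ?M = card ?L" by (simp add: card_image)
  then show ?thesis
    using assms finA by (simp add: card_cartesian_product card_Diff_subset)
qed

text \<open>Rotation permutes the finite set of orderings. This allows initial blocks to be replaced
  by blocks at any starting position of the cycle.\<close>

lemma sum_permutations_rotate:
  "(\<Sum>xs\<in>permutations_of_set S. f (rotate i xs)) = (\<Sum>xs\<in>permutations_of_set S. f xs)"
proof (rule sum.reindex_bij_betw)
  have "inj_on (rotate i) (permutations_of_set S)"
    by (rule inj_on_subset[OF _ subset_UNIV]) (simp add: rotate_def inj_fn inj_rotate1)
  moreover have "rotate i ` permutations_of_set S \<subseteq> permutations_of_set S"
    by (auto simp: permutations_of_set_def)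
  ultimately show "bij_betw (rotate i) (permutations_of_set S) (permutations_of_set S)"
    by (simp add: bij_betw_def endo_inj_surj)
qed

section \<open>The weighted inequality for intersecting antichains\<close>

text \<open>Double counting over all orderings and rotations, an occurrence of \<open>A\<close> as
  initial block having weight \<open>1 / card A\<close>. A fixed \<open>A\<close> contributes
  \<open>fact (n - 1) / ((n - 1) choose (card A - 1))\<close> for each rotation, while a fixed
  ordering contributes at most 1 over all its rotations.\<close>

lemma sum_inverse_binomial_le_1:
  assumes S: "finite S" "card S = n"
    and F: "F \<subseteq> Pow S" "F \<noteq> {}"
    and small: "\<And>A. A \<in> F \<Longrightarrow> 2 * card A \<le> n"
    and meet: "\<And>A B. A \<in> F \<Longrightarrow> B \<in> F \<Longrightarrow> A \<inter> B \<noteq> {}"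
    and anti: "\<And>A B. A \<in> F \<Longrightarrow> B \<in> F \<Longrightarrow> A \<subseteq> B \<Longrightarrow> A = B"
  shows "(\<Sum>A\<in>F. 1 / real ((n - 1) choose (card A - 1))) \<le> 1"
proof -
  let ?P = "permutations_of_set S"
  let ?w = "\<lambda>xs. \<Sum>A\<in>F. if set (take (card A) xs) = A then 1 / real (card A) else 0"
  have finF: "finite F" using F S finite_subset by blast
  \<comment> \<open>Applying \<open>meet\<close> to \<open>A\<close> and itself excludes the empty
    set.\<close>
  have posA: "0 < card A" if "A \<in> F" for A
    using meet[OF that that] F S that by (metis Pow_iff card_gt_0_iff finite_subset inf.idem subsetD)
  have npos: "0 < n" using F(2) posA small by fastforce
  have cycle: "(\<Sum>i<n. ?w (rotate i xs)) \<le> 1" if "xs \<in> ?P" for xs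
  proof -
    let ?T = "{(i, A). i < n \<and> A \<in> F \<and> set (take (card A) (rotate i xs)) = A}"
    have xs: "distinct xs" "length xs = n"
      using that S distinct_card[of xs] by (auto simp: permutations_of_set_def)
    have finT: "finite ?T"
      by (rule finite_subset[of _ "{..<n} \<times> F"]) (use finF in auto)
    have "(\<Sum>i<n. ?w (rotate i xs))
        = (\<Sum>(i, A)\<in>{..<n} \<times> F. if set (take (card A) (rotate i xs)) = A then 1 / real (card A) else 0)"
      by (simp add: sum.cartesian_product)
    also have "\<dots> = (\<Sum>(i, A)\<in>?T. 1 / real (card A))"
      by (rule sum.mono_neutral_cong_right) (use finF in \<open>auto split: if_splits\<close>)
    \<comment> \<open>By the cycle bound, every set occurring on the cycle has at least
      \<open>card ?T\<close> elements, so each of the \<open>card ?T\<close> weights is at most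
      \<open>1 / card ?T\<close>. If \<open>?T\<close> is empty, the sum is 0.\<close>
    also have "\<dots> \<le> (\<Sum>x\<in>?T. 1 / real (card ?T))"
    proof (rule sum_mono)
      fix x assume x: "x \<in> ?T"
      obtain i A where [simp]: "x = (i, A)" by fastforce
      have "card ?T \<le> card A"
        using x card_arcs_le[OF xs finF small meet anti, of A i] by simp
      moreover have "0 < card ?T" using x finT card_gt_0_iff by blast
      ultimately show "(case x of (i, A) \<Rightarrow> 1 / real (card A)) \<le> 1 / real (card ?T)"
        by (simp add: frac_le)
    qed
    also have "\<dots> \<le> 1" by simp
    finally show ?thesis .
  qed
  have count: "(\<Sum>xs\<in>?P. if set (take (card A) xs) = A then 1 / real (card A) else 0)
      = fact (n - 1) / real ((n - 1) choose (card A - 1))" if A: "A \<in> F" for A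
  proof -
    have "(\<Sum>xs\<in>?P. if set (take (card A) xs) = A then 1 / real (card A) else 0)
        = real (card {xs \<in> ?P. set (take (card A) xs) = A}) / real (card A)"
      by (simp add: sum.If_cases Int_def)
    also have "\<dots> = fact (card A) * fact (n - card A) / real (card A)"
      using card_permutations_with_prefix_set[of S A] A F S by auto
    also have "\<dots> = fact (card A - 1) * fact (n - card A)"
      using posA[OF A] by (simp add: fact_reduce)
    also have "\<dots> = fact (n - 1) / real ((n - 1) choose (card A - 1))"
    proof -
      have "card A - 1 \<le> n - 1" "n - 1 - (card A - 1) = n - card A"
        using small[OF A] posA[OF A] by auto
      then show ?thesis
        using binomial_fact[of "card A - 1" "n - 1", where ?'a = real] by simp
    qed
    finally show ?thesis .
  qed
  \<comment> \<open>The factor \<open>n\<close> counts the rotations: the sum over orderings is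
    replaced by \<open>n\<close> equal rotated sums, to be regrouped by ordering. There are
    \<open>n * fact (n - 1)\<close> orderings, which cancels the factor on the left.\<close>
  have "real n * (fact (n - 1) * (\<Sum>A\<in>F. 1 / real ((n - 1) choose (card A - 1))))
      = real n * (\<Sum>A\<in>F. \<Sum>xs\<in>?P. if set (take (card A) xs) = A then 1 / real (card A) else 0)"
    by (simp add: count sum_distrib_left)
  also have "\<dots> = real n * (\<Sum>xs\<in>?P. ?w xs)"
    by (subst sum.swap) simp
  also have "\<dots> = (\<Sum>i<n. \<Sum>xs\<in>?P. ?w (rotate i xs))"
    using sum_permutations_rotate[of ?w _ S] by simp
  also have "\<dots> = (\<Sum>xs\<in>?P. \<Sum>i<n. ?w (rotate i xs))"
    by (rule sum.swap)
  also have "\<dots> \<le> (\<Sum>xs\<in>?P. 1)"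
    by (rule sum_mono) (rule cycle)
  also have "\<dots> = real n * fact (n - 1)"
    using S npos by (simp add: fact_reduce)
  finally show ?thesis using npos by simp
qed

section \<open>Upper bound for perfect sets\<close>

lemma finite_bit_vectors: "finite (bit_vectors n)"
  using finite_lists_length_eq[of "UNIV :: bool set" n] by (simp add: bit_vectors_def)

lemma card_perfect_le:
  assumes "n \<ge> 4" "perfect n V"
  shows "card V \<le> (n - 1) choose (n div 2 - 1)"
proof -
  have finV: "finite V" and ne: "V \<noteq> {}"
    using assms(2) by (auto simp: perfect_def intro: finite_subset[OF _ finite_bit_vectors])
  have indep: "\<exists>r<n. u ! r = a \<and> v ! r = b" if "u \<in> V" "v \<in> V" "u \<noteq> v" for u v a b
    using assms(2) that by (auto simp: perfect_def)
  \<comment> \<open>\<open>minor v\<close> is a truth value taken by \<open>v\<close> in at most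
    half of the positions, with \<open>True\<close> chosen in a tie. Thus \<open>f v\<close> is the
    support of \<open>v\<close> or of its complement.\<close>
  define minor where "minor v \<longleftrightarrow> 2 * card {r. r < n \<and> v ! r} \<le> n" for v
  define f where "f v = {r. r < n \<and> v ! r = minor v}" for v
  have f_small: "2 * card (f v) \<le> n" for v
  proof (cases "minor v")
    case True
    then show ?thesis by (simp add: f_def minor_def)
  next
    case False
    then have "f v = {..<n} - {r. r < n \<and> v ! r}" by (auto simp: f_def)
    then have "card (f v) = n - card {r. r < n \<and> v ! r}"
      by (simp add: card_Diff_subset subset_eq)
    then show ?thesis using False by (simp add: minor_def)
  qed
  have f_meet: "f u \<inter> f v \<noteq> {}" if uv: "u \<in> V" "v \<in> V" for u v
  proof -
    \<comment> \<open>For \<open>u = v\<close>, nonemptiness of \<open>f u\<close> needs a second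
      vector, supplied by \<open>card V >= 2\<close>: some position realises \<open>minor u\<close>
      in \<open>u\<close> against an arbitrary value in \<open>w\<close>.\<close>
    obtain w where w: "w \<in> V" "w \<noteq> u"
    proof -
      have "\<not> V \<subseteq> {u}"
        using assms(2) card_mono[of "{u}" V] by (auto simp: perfect_def)
      then show ?thesis using that by blast
    qed
    show ?thesis
    proof (cases "u = v")
      case True
      then show ?thesis using indep[of u w "minor u" True] w uv by (auto simp: f_def)
    next
      case False
      then show ?thesis using indep[of u v "minor u" "minor v"] uv by (auto simp: f_def)
    qed
  qed
  \<comment> \<open>A position showing \<open>minor u\<close> in \<open>u\<close> and the opposite
    of \<open>minor v\<close> in \<open>v\<close> lies in \<open>f u\<close> but not in
    \<open>f v\<close>. This yields injectivity of \<open>f\<close> as well as the antichain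
    property.\<close>
  have f_anti: "u = v" if "u \<in> V" "v \<in> V" "f u \<subseteq> f v" for u v
    using indep[of u v "minor u" "\<not> minor v"] that by (auto simp: f_def)
  have "inj_on f V" using f_anti by (auto intro!: inj_onI)
  then have card_f: "card (f ` V) = card V" by (rule card_image)
  have bound: "1 / real ((n - 1) choose (n div 2 - 1)) \<le> 1 / real ((n - 1) choose (card A - 1))"
    if "A \<in> f ` V" for A
  proof -
    have "2 * card A \<le> n" using that f_small by auto
    \<comment> \<open>The index \<open>n div 2 - 1\<close> lies in the lower half of row
      \<open>n - 1\<close>, where binomial coefficients grow with the lower index.\<close>
    then have "(n - 1) choose (card A - 1) \<le> (n - 1) choose (n div 2 - 1)"
      using assms(1) by (intro binomial_mono) auto
    moreover have "0 < (n - 1) choose (card A - 1)"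
      using \<open>2 * card A \<le> n\<close> assms(1) by (intro zero_less_binomial) auto
    ultimately show ?thesis by (simp add: frac_le)
  qed
  have "real (card V) / real ((n - 1) choose (n div 2 - 1))
      = (\<Sum>A\<in>f ` V. 1 / real ((n - 1) choose (n div 2 - 1)))"
    by (simp add: card_f)
  also have "\<dots> \<le> (\<Sum>A\<in>f ` V. 1 / real ((n - 1) choose (card A - 1)))"
    by (rule sum_mono) (rule bound)
  also have "\<dots> \<le> 1"
  proof (rule sum_inverse_binomial_le_1[of "{..<n}"])
    show "f ` V \<subseteq> Pow {..<n}" by (auto simp: f_def)
    show "card {..<n} = n" by simp
  qed (use finite_lessThan f_small f_meet f_anti ne in blast)+
  finally have "real (card V) / real ((n - 1) choose (n div 2 - 1)) \<le> 1" .
  moreover have "0 < (n - 1) choose (n div 2 - 1)"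
    using assms(1) by (intro zero_less_binomial) auto
  ultimately show ?thesis by (simp add: divide_le_eq)
qed

section \<open>Extremal construction\<close>

text \<open>The common entry 1 at list position 0 gives the pattern 11. Distinct sets of equal size
  have elements outside each other, giving 10 and 01. Two sets of size \<open>m - 1\<close> cannot
  cover the other \<open>n - 1\<close> positions, giving 00.\<close>

lemma perfect_exists:
  assumes "n \<ge> 4"
  shows "\<exists>V. perfect n V \<and> card V = (n - 1) choose (n div 2 - 1)"
proof -
  define m where "m = n div 2"
  define K where "K = {B. B \<subseteq> {1..<n} \<and> card B = m - 1}"
  define vec where "vec B = map (\<lambda>r. r \<in> insert 0 B) [0..<n]" for B :: "nat set"
  have m: "2 \<le> m" "2 * m \<le> n" using assms by (auto simp: m_def)
  have nth: "vec B ! r \<longleftrightarrow> r \<in> insert 0 B" if "r < n" for B r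
    using that by (simp add: vec_def)
  have len: "length (vec B) = n" for B by (simp add: vec_def)
  have inj: "inj_on vec K"
  proof (rule inj_onI)
    fix A B assume AB: "A \<in> K" "B \<in> K" "vec A = vec B"
    have "r \<in> A \<longleftrightarrow> r \<in> B" if "r \<in> {1..<n}" for r
      using nth[of r A] nth[of r B] AB that by auto
    then show "A = B" using AB by (auto simp: K_def)
  qed
  have card_K: "card K = (n - 1) choose (m - 1)"
    by (simp add: K_def n_subsets)
  \<comment> \<open>This secures the size condition \<open>card V >= 2\<close>. The comparison with
    index 1 uses \<open>m >= 2\<close>, which comes from \<open>n >= 4\<close>.\<close>
  have "n - 1 \<le> (n - 1) choose (m - 1)"
  proof -
    have "(n - 1) choose 1 \<le> (n - 1) choose (m - 1)"
      using m by (intro binomial_mono) auto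
    then show ?thesis by simp
  qed
  then have two: "2 \<le> card (vec ` K)"
    using assms by (simp add: card_image inj card_K)
  have "\<exists>r<n. vec A ! r = a \<and> vec B ! r = b" if AB: "A \<in> K" "B \<in> K" "A \<noteq> B" for A B a b
  proof -
    have fin: "finite A" "finite B" and sub: "A \<subseteq> {1..<n}" "B \<subseteq> {1..<n}"
      using AB finite_subset by (auto simp: K_def)
    have card: "card A = m - 1" "card B = m - 1" using AB by (auto simp: K_def)
    obtain r where r: "r \<in> A" "r \<notin> B"
      using card_subset_eq[OF fin(2), of A] AB card by auto
    obtain s where s: "s \<in> B" "s \<notin> A"
      using card_subset_eq[OF fin(1), of B] AB card by auto
    \<comment> \<open>The union has at most \<open>2 * (m - 1) <= n - 2\<close> elements, one fewer
      than the \<open>n - 1\<close> available positions.\<close>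
    have "card (A \<union> B) < card {1..<n}"
      using card_Un_le[of A B] card m by simp
    then have "\<not> {1..<n} \<subseteq> A \<union> B"
      using card_mono[of "A \<union> B" "{1..<n}"] fin by auto
    then obtain t where t: "t \<in> {1..<n}" "t \<notin> A" "t \<notin> B" by blast
    have "r < n" "r \<noteq> 0" "s < n" "s \<noteq> 0" using r s sub by auto
    then show ?thesis
      using r s t nth assms
      by (cases a; cases b) (auto intro: exI[of _ 0] exI[of _ r] exI[of _ s] exI[of _ t])
  qed
  then have "perfect n (vec ` K)"
    using two unfolding perfect_def by (fastforce simp: bit_vectors_def len)
  then show ?thesis using card_K inj by (auto simp: card_image m_def)
qed

theorem theorem2:
  fixes n :: nat
  assumes "n \<ge> 4"
  shows "p n = (n - 1) choose (n div 2 - 1)"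
  unfolding p_def
proof (rule Max_eqI)
  show "finite {card V | V. perfect n V}"
    using finite_bit_vectors[of n]
    by (auto intro!: finite_subset[of _ "card ` Pow (bit_vectors n)"] simp: perfect_def)
next
  show "y \<le> (n - 1) choose (n div 2 - 1)" if "y \<in> {card V | V. perfect n V}" for y
    using that card_perfect_le[OF assms] by auto
next
  show "(n - 1) choose (n div 2 - 1) \<in> {card V | V. perfect n V}"
    using perfect_exists[OF assms] by force
qed

end
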